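(* Let $\Gamma_1$ be a signed bipartite graph and $\Gamma_2$ be a signed graph. The spectrum of the signed Cartesian product $\Gamma_1\widetilde{\Box}\Gamma_2$ (resp. of the signed semi-strong product $\Gamma_1\widetilde{\bowtie}\Gamma_2$) is symmetric if and only if $\Gamma_1$ is balanced or the spectrum of $\Gamma_2$ is symmetric.
   Context: A signed graph $\Gamma=(G,\sigma)$ is a finite simple undirected graph $G$ together with a map $\sigma:E(G)\to\{+1,-1\}$. Its adjacency matrix $A(\Gamma)$ is the real symmetric matrix indexed by $V(G)$ whose $(u,v)$ entry is $\sigma(uv)$ if $u,v$ are adjacent and $0$ otherwise. The spectrum of $\Gamma$ is that of $A(\Gamma)$; it is symmetric if, counted with multiplicity, it is invariant under $x\mapsto -x$. Graph notions (order, bipartite) refer to $G$. A signed bipartite graph $\Gamma_1=(G_1,\sigma_1)$ of order $n$ is taken with a fixed bipartition $(V_1,V_2)$, $|V_1|=s$ (unique up to interchanging the classes when the graph is connected); it is balanced if $|V_1|=|V_2|$. Labeling the vertices of $V_1$ first, $A(\Gamma_1)=\begin{bmatrix}O_s&P\\P^T&O_{n-s}\end{bmatrix}$. For a signed graph $\Gamma_2=(G_2,\sigma_2)$ of order $m$, the signed Cartesian product $\Gamma_1\widetilde{\Box}\Gamma_2$ and the signed semi-strong product $\Gamma_1\widetilde{\bowtie}\Gamma_2$ are the signed graphs on $V(G_1)\times V(G_2)$ with adjacency matrices $$A(\Gamma_1\widetilde{\Box}\Gamma_2)=A(\Gamma_1)\otimes I_m+\begin{bmatrix}I_s&O\\O&-I_{n-s}\end{bmatrix}\otimes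 A(\Gamma_2),\qquad A(\Gamma_1\widetilde{\bowtie}\Gamma_2)=\begin{bmatrix}I_s&P\\P^T&-I_{n-s}\end{bmatrix}\otimes A(\Gamma_2),$$ where $\otimes$ is the Kronecker product. *)

theory Defs
  imports "Jordan_Normal_Form.Char_Poly"
begin

section \<open>Signed graphs\<close>

record 'a sgraph =
  verts :: "'a set"
  edges :: "'a set set"
  esign :: "'a set \<Rightarrow> real"

definition signed_graph :: "'a sgraph \<Rightarrow> bool" where
  "signed_graph \<Gamma> \<longleftrightarrow> finite (verts \<Gamma>) \<and>
     (\<forall>e\<in>edges \<Gamma>. \<exists>u\<in>verts \<Gamma>. \<exists>v\<in>verts \<Gamma>. u \<noteq> v \<and> e = {u, v}) \<and>
     (\<forall>e\<in>edges \<Gamma>. esign \<Gamma> e \<in> {1, -1})"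

definition adj :: "'a sgraph \<Rightarrow> 'a \<Rightarrow> 'a \<Rightarrow> real" where
  "adj \<Gamma> u v = (if {u, v} \<in> edges \<Gamma> then esign \<Gamma> {u, v} else 0)"

definition labeling :: "'a sgraph \<Rightarrow> 'a list \<Rightarrow> bool" where
  "labeling \<Gamma> vs \<longleftrightarrow> distinct vs \<and> set vs = verts \<Gamma>"

definition adj_mat :: "'a sgraph \<Rightarrow> 'a list \<Rightarrow> real mat" where
  "adj_mat \<Gamma> vs = mat (length vs) (length vs) (\<lambda>(i, j). adj \<Gamma> (vs ! i) (vs ! j))"

text \<open>The eigenvalues with multiplicity; as the adjacency matrix is real symmetric, all of them
  are real. The choice of the labeling is immaterial, see \<open>graph_spectrum_labeling\<close> below.\<close>

definition graph_spectrum :: "'a sgraph \<Rightarrow> real multiset" where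
  "graph_spectrum \<Gamma> = proots (char_poly (adj_mat \<Gamma> (SOME vs. labeling \<Gamma> vs)))"

definition symmetric_spectrum :: "'a sgraph \<Rightarrow> bool" where
  "symmetric_spectrum \<Gamma> \<longleftrightarrow> image_mset uminus (graph_spectrum \<Gamma>) = graph_spectrum \<Gamma>"

lemma char_poly_adj_mat_labeling:
  assumes vs: "labeling \<Gamma> vs" and ws: "labeling \<Gamma> ws"
  shows "char_poly (adj_mat \<Gamma> vs) = char_poly (adj_mat \<Gamma> ws)"
proof -
  define n where "n = length vs"
  have lw: "length ws = n"
    using vs ws unfolding labeling_def n_def by (metis distinct_card)
  have "\<exists>f. \<forall>i<n. f i < n \<and> ws ! f i = vs ! i"
  proof -
    have "\<forall>i. \<exists>k. i < n \<longrightarrow> k < n \<and> ws ! k = vs ! i"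
      using vs ws lw unfolding labeling_def n_def by (metis in_set_conv_nth)
    then show ?thesis by metis
  qed
  then obtain f where f: "\<And>i. i < n \<Longrightarrow> f i < n" "\<And>i. i < n \<Longrightarrow> ws ! f i = vs ! i" by blast
  have "\<exists>g. \<forall>i<n. g i < n \<and> vs ! g i = ws ! i"
  proof -
    have "\<forall>i. \<exists>k. i < n \<longrightarrow> k < n \<and> vs ! k = ws ! i"
      using vs ws lw unfolding labeling_def n_def by (metis in_set_conv_nth)
    then show ?thesis by metis
  qed
  then obtain g where g: "\<And>i. i < n \<Longrightarrow> g i < n" "\<And>i. i < n \<Longrightarrow> vs ! g i = ws ! i" by blast
  have dv: "i < n \<Longrightarrow> j < n \<Longrightarrow> vs ! i = vs ! j \<longleftrightarrow> i = j" for i j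
    using vs unfolding labeling_def n_def by (simp add: nth_eq_iff_index_eq)
  have dw: "i < n \<Longrightarrow> j < n \<Longrightarrow> ws ! i = ws ! j \<longleftrightarrow> i = j" for i j
    using ws lw unfolding labeling_def by (simp add: nth_eq_iff_index_eq)
  have fg: "f (g i) = i" "g (f i) = i" if "i < n" for i
    using that f g dv dw by metis+
  define P :: "real mat" where "P = mat n n (\<lambda>(i, j). if j = f i then 1 else 0)"
  define Q :: "real mat" where "Q = mat n n (\<lambda>(i, j). if i = f j then 1 else 0)"
  define A where "A = adj_mat \<Gamma> vs"
  define B where "B = adj_mat \<Gamma> ws"
  have A: "A \<in> carrier_mat n n" and B: "B \<in> carrier_mat n n"
    unfolding A_def B_def adj_mat_def using lw by (auto simp: n_def)
  have P: "P \<in> carrier_mat n n" and Q: "Q \<in> carrier_mat n n"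
    unfolding P_def Q_def by auto
  have if_mult: "(if b then 1 else 0) * (x::real) = (if b then x else 0)"
    "x * (if b then 1 else 0) = (if b then x else 0)" for b x by auto
  have PQ: "P * Q = 1\<^sub>m n"
  proof (rule eq_matI)
    fix i j assume "i < dim_row (1\<^sub>m n :: real mat)" "j < dim_col (1\<^sub>m n :: real mat)"
    then have ij: "i < n" "j < n" by auto
    then have "f j = f i \<longleftrightarrow> i = j" using fg by metis
    then show "(P * Q) $$ (i, j) = 1\<^sub>m n $$ (i, j)"
      using ij f by (simp add: P_def Q_def scalar_prod_def if_mult)
  qed (auto simp: P_def Q_def)
  have QP: "Q * P = 1\<^sub>m n" by (rule mat_mult_left_right_inverse[OF P Q PQ])
  have PB: "P * B = mat n n (\<lambda>(i, j). B $$ (f i, j))"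
    using B f by (intro eq_matI) (auto simp: P_def scalar_prod_def if_mult)
  have PBQ: "A = P * B * Q"
  proof (rule eq_matI)
    fix i j assume "i < dim_row (P * B * Q)" "j < dim_col (P * B * Q)"
    then have ij: "i < n" "j < n" by (auto simp: P_def Q_def)
    have "(P * B * Q) $$ (i, j) = B $$ (f i, f j)"
      unfolding PB using ij f by (simp add: Q_def scalar_prod_def if_mult)
    also have "\<dots> = A $$ (i, j)"
      using ij f lw by (simp add: A_def B_def adj_mat_def n_def)
    finally show "A $$ (i, j) = (P * B * Q) $$ (i, j)" by simp
  qed (use A in \<open>auto simp: P_def Q_def\<close>)
  have "similar_mat A B"
    unfolding similar_mat_def similar_mat_wit_def Let_def
    using A B P Q PQ QP PBQ by (intro exI[of _ P] exI[of _ Q]) auto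
  then show ?thesis unfolding A_def B_def by (rule char_poly_similar)
qed

lemma graph_spectrum_labeling:
  assumes "labeling \<Gamma> vs"
  shows "graph_spectrum \<Gamma> = proots (char_poly (adj_mat \<Gamma> vs))"
  unfolding graph_spectrum_def
  using char_poly_adj_mat_labeling[OF someI[of "labeling \<Gamma>", OF assms] assms] by simp

section \<open>Bipartitions and products\<close>

text \<open>A class may be empty, as it must be for the one-vertex graph.\<close>

definition bipartition :: "'a sgraph \<Rightarrow> 'a set \<Rightarrow> 'a set \<Rightarrow> bool" where
  "bipartition \<Gamma> V1 V2 \<longleftrightarrow> V1 \<union> V2 = verts \<Gamma> \<and> V1 \<inter> V2 = {} \<and>
     (\<forall>e\<in>edges \<Gamma>. \<exists>u\<in>V1. \<exists>v\<in>V2. e = {u, v})"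

definition balanced :: "'a set \<Rightarrow> 'a set \<Rightarrow> bool" where
  "balanced V1 V2 \<longleftrightarrow> card V1 = card V2"

text \<open>The signed graph with a prescribed adjacency matrix, given as a symmetric function
  \<open>V \<Rightarrow> V \<Rightarrow> {0, 1, -1}\<close> vanishing on the diagonal.\<close>

definition sgraph_of :: "'a set \<Rightarrow> ('a \<Rightarrow> 'a \<Rightarrow> real) \<Rightarrow> 'a sgraph" where
  "sgraph_of V a = \<lparr>verts = V,
     edges = {{u, v} |u v. u \<in> V \<and> v \<in> V \<and> a u v \<noteq> 0},
     esign = (\<lambda>e. if \<exists>u\<in>V. \<exists>v\<in>V. e = {u, v} \<and> a u v = 1 then 1 else -1)\<rparr>"

text \<open>The entries of the block matrices diag(I, -I) and I.\<close>

definition class_diag :: "'a set \<Rightarrow> 'a \<Rightarrow> 'a \<Rightarrow> real" where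
  "class_diag V1 u v = (if u = v then if u \<in> V1 then 1 else -1 else 0)"

definition id_entry :: "'a \<Rightarrow> 'a \<Rightarrow> real" where
  "id_entry u v = (if u = v then 1 else 0)"

text \<open>The block matrix forms of the next two definitions are \<open>adj_mat_cartesian\<close> and
  \<open>adj_mat_semi_strong\<close> below.\<close>

definition signed_cartesian :: "'a sgraph \<Rightarrow> 'a set \<Rightarrow> 'b sgraph \<Rightarrow> ('a \<times> 'b) sgraph" where
  "signed_cartesian \<Gamma>1 V1 \<Gamma>2 = sgraph_of (verts \<Gamma>1 \<times> verts \<Gamma>2)
     (\<lambda>(u, x) (v, y). adj \<Gamma>1 u v * id_entry x y + class_diag V1 u v * adj \<Gamma>2 x y)"

definition signed_semi_strong :: "'a sgraph \<Rightarrow> 'a set \<Rightarrow> 'b sgraph \<Rightarrow> ('a \<times> 'b) sgraph" where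
  "signed_semi_strong \<Gamma>1 V1 \<Gamma>2 = sgraph_of (verts \<Gamma>1 \<times> verts \<Gamma>2)
     (\<lambda>(u, x) (v, y). (class_diag V1 u v + adj \<Gamma>1 u v) * adj \<Gamma>2 x y)"

section \<open>The products have the intended adjacency matrices\<close>

lemma adj_sym: "adj \<Gamma> u v = adj \<Gamma> v u"
  by (simp add: adj_def insert_commute)

lemma adj_range: "signed_graph \<Gamma> \<Longrightarrow> adj \<Gamma> u v \<in> {0, 1, -1}"
  by (auto simp: adj_def signed_graph_def)

lemma adj_diag: "signed_graph \<Gamma> \<Longrightarrow> adj \<Gamma> u u = 0"
  by (auto simp: adj_def signed_graph_def doubleton_eq_iff)

lemma
  assumes "finite V" and "\<And>u v. u \<in> V \<Longrightarrow> v \<in> V \<Longrightarrow> a u v \<in> {0, 1, -1}"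
    and sym: "\<And>u v. u \<in> V \<Longrightarrow> v \<in> V \<Longrightarrow> a u v = a v u" and "\<And>u. u \<in> V \<Longrightarrow> a u u = 0"
  shows signed_graph_sgraph_of: "signed_graph (sgraph_of V a)"
    and adj_sgraph_of: "u \<in> V \<Longrightarrow> v \<in> V \<Longrightarrow> adj (sgraph_of V a) u v = a u v"
proof -
  show "signed_graph (sgraph_of V a)"
    unfolding signed_graph_def
  proof (intro conjI ballI)
    show "finite (verts (sgraph_of V a))" using assms(1) by (simp add: sgraph_of_def)
  next
    fix e assume "e \<in> edges (sgraph_of V a)"
    then obtain u v where e: "u \<in> V" "v \<in> V" "a u v \<noteq> 0" "e = {u, v}"
      by (auto simp: sgraph_of_def)
    then have "u \<noteq> v" using assms(4) by blast
    then show "\<exists>u\<in>verts (sgraph_of V a). \<exists>v\<in>verts (sgraph_of V a). u \<noteq> v \<and> e = {u, v}"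
      using e by (auto simp: sgraph_of_def)
  next
    fix e show "esign (sgraph_of V a) e \<in> {1, -1}" by (simp add: sgraph_of_def)
  qed
next
  assume uv: "u \<in> V" "v \<in> V"
  have 1: "(\<exists>u'\<in>V. \<exists>v'\<in>V. {u, v} = {u', v'} \<and> a u' v' = 1) \<longleftrightarrow> a u v = 1"
    using uv sym by (auto simp: doubleton_eq_iff)
  have 2: "{u, v} \<in> edges (sgraph_of V a) \<longleftrightarrow> a u v \<noteq> 0"
    using uv sym by (auto simp: doubleton_eq_iff sgraph_of_def)
  show "adj (sgraph_of V a) u v = a u v"
    unfolding adj_def 2 using assms(2)[OF uv] 1 by (auto simp: sgraph_of_def)
qed

lemma cartesian_entries:
  fixes V1 :: "'a set"
  assumes "signed_graph \<Gamma>1" "signed_graph \<Gamma>2"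
  defines "a \<equiv> (\<lambda>(u, x) (v, y). adj \<Gamma>1 u v * id_entry x y + class_diag V1 u v * adj \<Gamma>2 x y)"
  shows "a p q \<in> {0, 1, -1}" "a p q = a q p" "a p p = 0"
proof -
  obtain u x v y where pq: "p = (u, x)" "q = (v, y)" by fastforce
  show "a p q \<in> {0, 1, -1}"
    using adj_range[OF assms(1), of u v] adj_range[OF assms(2), of x y]
      adj_diag[OF assms(1), of u] adj_diag[OF assms(2), of x]
    by (cases "u = v"; cases "x = y") (simp_all add: a_def pq id_entry_def class_diag_def, auto?)
  show "a p q = a q p"
    using adj_sym[of \<Gamma>1 u v] adj_sym[of \<Gamma>2 x y]
    by (cases "u = v"; cases "x = y") (simp_all add: a_def pq id_entry_def class_diag_def)
  show "a p p = 0"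
    using adj_diag[OF assms(1), of u] adj_diag[OF assms(2), of x]
    by (simp add: a_def pq)
qed

lemma semi_strong_entries:
  fixes V1 :: "'a set"
  assumes "signed_graph \<Gamma>1" "signed_graph \<Gamma>2"
  defines "a \<equiv> (\<lambda>(u, x) (v, y). (class_diag V1 u v + adj \<Gamma>1 u v) * adj \<Gamma>2 x y)"
  shows "a p q \<in> {0, 1, -1}" "a p q = a q p" "a p p = 0"
proof -
  obtain u x v y where pq: "p = (u, x)" "q = (v, y)" by fastforce
  show "a p q \<in> {0, 1, -1}"
    using adj_range[OF assms(1), of u v] adj_range[OF assms(2), of x y]
      adj_diag[OF assms(1), of u] adj_diag[OF assms(2), of x]
    by (cases "u = v"; cases "x = y") (simp_all add: a_def pq class_diag_def, auto?)
  show "a p q = a q p"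
    using adj_sym[of \<Gamma>1 u v] adj_sym[of \<Gamma>2 x y]
    by (cases "u = v"; cases "x = y") (simp_all add: a_def pq class_diag_def)
  show "a p p = 0"
    using adj_diag[OF assms(1), of u] adj_diag[OF assms(2), of x]
    by (simp add: a_def pq)
qed

lemma
  assumes "signed_graph \<Gamma>1" "signed_graph \<Gamma>2"
  shows signed_graph_cartesian: "signed_graph (signed_cartesian \<Gamma>1 V1 \<Gamma>2)"
    and adj_cartesian: "u \<in> verts \<Gamma>1 \<Longrightarrow> v \<in> verts \<Gamma>1 \<Longrightarrow> x \<in> verts \<Gamma>2 \<Longrightarrow> y \<in> verts \<Gamma>2 \<Longrightarrow>
      adj (signed_cartesian \<Gamma>1 V1 \<Gamma>2) (u, x) (v, y) =
        adj \<Gamma>1 u v * id_entry x y + class_diag V1 u v * adj \<Gamma>2 x y"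
    and signed_graph_semi_strong: "signed_graph (signed_semi_strong \<Gamma>1 V1 \<Gamma>2)"
    and adj_semi_strong: "u \<in> verts \<Gamma>1 \<Longrightarrow> v \<in> verts \<Gamma>1 \<Longrightarrow> x \<in> verts \<Gamma>2 \<Longrightarrow> y \<in> verts \<Gamma>2 \<Longrightarrow>
      adj (signed_semi_strong \<Gamma>1 V1 \<Gamma>2) (u, x) (v, y) =
        (class_diag V1 u v + adj \<Gamma>1 u v) * adj \<Gamma>2 x y"
proof -
  have fin: "finite (verts \<Gamma>1 \<times> verts \<Gamma>2)"
    using assms by (simp add: signed_graph_def)
  show "signed_graph (signed_cartesian \<Gamma>1 V1 \<Gamma>2)" unfolding signed_cartesian_def
    by (rule signed_graph_sgraph_of[OF fin cartesian_entries[OF assms]])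
  show "signed_graph (signed_semi_strong \<Gamma>1 V1 \<Gamma>2)" unfolding signed_semi_strong_def
    by (rule signed_graph_sgraph_of[OF fin semi_strong_entries[OF assms]])
  assume "u \<in> verts \<Gamma>1" "v \<in> verts \<Gamma>1" "x \<in> verts \<Gamma>2" "y \<in> verts \<Gamma>2"
  then have m: "(u, x) \<in> verts \<Gamma>1 \<times> verts \<Gamma>2" "(v, y) \<in> verts \<Gamma>1 \<times> verts \<Gamma>2" by auto
  show "adj (signed_cartesian \<Gamma>1 V1 \<Gamma>2) (u, x) (v, y) =
        adj \<Gamma>1 u v * id_entry x y + class_diag V1 u v * adj \<Gamma>2 x y"
    unfolding signed_cartesian_def
    by (subst adj_sgraph_of[OF fin cartesian_entries[OF assms] m]) simp
  show "adj (signed_semi_strong \<Gamma>1 V1 \<Gamma>2) (u, x) (v, y) =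
        (class_diag V1 u v + adj \<Gamma>1 u v) * adj \<Gamma>2 x y"
    unfolding signed_semi_strong_def
    by (subst adj_sgraph_of[OF fin semi_strong_entries[OF assms] m]) simp
qed

definition kronecker :: "real mat \<Rightarrow> real mat \<Rightarrow> real mat" where
  "kronecker A B = mat (dim_row A * dim_row B) (dim_col A * dim_col B)
     (\<lambda>(i, j). A $$ (i div dim_row B, j div dim_col B) * B $$ (i mod dim_row B, j mod dim_col B))"

definition biadj_mat :: "'a sgraph \<Rightarrow> 'a list \<Rightarrow> 'a list \<Rightarrow> real mat" where
  "biadj_mat \<Gamma> xs ys = mat (length xs) (length ys) (\<lambda>(i, j). adj \<Gamma> (xs ! i) (ys ! j))"

lemma adj_same_class:
  assumes "bipartition \<Gamma> V1 V2"
  shows "u \<in> V1 \<Longrightarrow> v \<in> V1 \<Longrightarrow> adj \<Gamma> u v = 0" "u \<in> V2 \<Longrightarrow> v \<in> V2 \<Longrightarrow> adj \<Gamma> u v = 0"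
proof -
  have "{u, v} \<notin> edges \<Gamma>" if "u \<in> V1 \<and> v \<in> V1 \<or> u \<in> V2 \<and> v \<in> V2"
  proof
    assume e: "{u, v} \<in> edges \<Gamma>"
    have "\<forall>e\<in>edges \<Gamma>. \<exists>p\<in>V1. \<exists>q\<in>V2. e = {p, q}"
      using assms unfolding bipartition_def by (elim conjE)
    then have "\<exists>p\<in>V1. \<exists>q\<in>V2. {u, v} = {p, q}" using e by (rule bspec)
    then obtain p q where "p \<in> V1" "q \<in> V2" "{u, v} = {p, q}" by (elim bexE)
    moreover have "V1 \<inter> V2 = {}" using assms by (simp add: bipartition_def)
    ultimately show False
      using that unfolding doubleton_eq_iff disjoint_iff by metis
  qed
  then show "u \<in> V1 \<Longrightarrow> v \<in> V1 \<Longrightarrow> adj \<Gamma> u v = 0" "u \<in> V2 \<Longrightarrow> v \<in> V2 \<Longrightarrow> adj \<Gamma> u v = 0"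
    by (simp_all add: adj_def)
qed

locale labeled_bipartite_pair =
  fixes \<Gamma>1 :: "'a sgraph" and \<Gamma>2 :: "'b sgraph" and V1 V2 xs ys ws
  assumes sg1: "signed_graph \<Gamma>1" and sg2: "signed_graph \<Gamma>2"
    and bip: "bipartition \<Gamma>1 V1 V2"
    and xs: "distinct xs" "set xs = V1" and ys: "distinct ys" "set ys = V2"
    and ws: "labeling \<Gamma>2 ws"
begin

abbreviation "s \<equiv> length xs"
abbreviation "t \<equiv> length ys"
abbreviation "m \<equiv> length ws"
abbreviation "P \<equiv> biadj_mat \<Gamma>1 xs ys"
abbreviation "vs \<equiv> List.product (xs @ ys) ws"

lemma in_verts:
  "i < s \<Longrightarrow> xs ! i \<in> V1" "j < t \<Longrightarrow> ys ! j \<in> V2" "k < m \<Longrightarrow> ws ! k \<in> verts \<Gamma>2"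
  "l < s + t \<Longrightarrow> (xs @ ys) ! l \<in> verts \<Gamma>1"
  "l < s + t \<Longrightarrow> (xs @ ys) ! l \<in> V1 \<longleftrightarrow> l < s"
proof -
  show "i < s \<Longrightarrow> xs ! i \<in> V1" "j < t \<Longrightarrow> ys ! j \<in> V2" "k < m \<Longrightarrow> ws ! k \<in> verts \<Gamma>2"
    using xs(2) ys(2) ws nth_mem unfolding labeling_def by metis+
  have cover: "V1 \<union> V2 = verts \<Gamma>1" and disj: "V1 \<inter> V2 = {}"
    using bip unfolding bipartition_def by - (elim conjE, assumption)+
  assume l: "l < s + t"
  have 1: "(xs @ ys) ! l \<in> V1" if "l < s"
    using that nth_mem[of l xs] xs(2) by (simp add: nth_append)
  have 2: "(xs @ ys) ! l \<in> V2" if "\<not> l < s"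
    using that l nth_mem[of "l - s" ys] ys(2) by (simp add: nth_append)
  show "(xs @ ys) ! l \<in> verts \<Gamma>1"
    unfolding cover[symmetric] using 1 2 by (cases "l < s") simp_all
  show "(xs @ ys) ! l \<in> V1 \<longleftrightarrow> l < s"
    using 1 2 disj unfolding disjoint_iff by metis
qed

lemma labeling_bipartite: "labeling \<Gamma>1 (xs @ ys)"
proof -
  have cover: "V1 \<union> V2 = verts \<Gamma>1" and disj: "V1 \<inter> V2 = {}"
    using bip unfolding bipartition_def by - (elim conjE, assumption)+
  show ?thesis using xs ys cover disj by (simp add: labeling_def)
qed

lemma labeling_products:
  "labeling (signed_cartesian \<Gamma>1 V1 \<Gamma>2) vs" "labeling (signed_semi_strong \<Gamma>1 V1 \<Gamma>2) vs"
  using labeling_bipartite ws unfolding labeling_def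
  by (auto simp: distinct_product signed_cartesian_def signed_semi_strong_def sgraph_of_def)

lemma adj_mat_bipartite:
  "adj_mat \<Gamma>1 (xs @ ys) = four_block_mat (0\<^sub>m s s) P (transpose_mat P) (0\<^sub>m t t)"
  using in_verts(1,2) adj_same_class[OF bip]
  by (intro eq_matI) (auto simp: adj_mat_def biadj_mat_def nth_append adj_sym)

lemma class_diag_mat:
  assumes "i < s + t" "j < s + t"
  shows "class_diag V1 ((xs @ ys) ! i) ((xs @ ys) ! j) =
    four_block_mat (1\<^sub>m s) (0\<^sub>m s t) (0\<^sub>m t s) (- 1\<^sub>m t) $$ (i, j)"
proof -
  have "(xs @ ys) ! i = (xs @ ys) ! j \<longleftrightarrow> i = j"
    using labeling_bipartite assms unfolding labeling_def by (intro nth_eq_iff_index_eq) auto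
  then show ?thesis
    using assms in_verts(5)[of i] by (auto simp: class_diag_def)
qed

lemma ws_eq: "i < m \<Longrightarrow> j < m \<Longrightarrow> ws ! i = ws ! j \<longleftrightarrow> i = j"
  using ws unfolding labeling_def by (simp add: nth_eq_iff_index_eq)

lemma div_mod_bounds:
  assumes "i < (s + t) * m"
  shows "i div m < s + t" "i mod m < m"
  using assms by (auto simp: less_mult_imp_div_less intro!: mod_less_divisor gr0I)

lemma adj_mat_cartesian:
  "adj_mat (signed_cartesian \<Gamma>1 V1 \<Gamma>2) vs =
     kronecker (adj_mat \<Gamma>1 (xs @ ys)) (1\<^sub>m m) +
     kronecker (four_block_mat (1\<^sub>m s) (0\<^sub>m s t) (0\<^sub>m t s) (- 1\<^sub>m t)) (adj_mat \<Gamma>2 ws)"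
  (is "?L = kronecker ?A _ + kronecker ?D ?B")
proof (rule eq_matI)
  fix i j
  assume "i < dim_row (kronecker ?A (1\<^sub>m m) + kronecker ?D ?B)"
    "j < dim_col (kronecker ?A (1\<^sub>m m) + kronecker ?D ?B)"
  then have ij: "i < (s + t) * m" "j < (s + t) * m" by (auto simp: kronecker_def adj_mat_def)
  note b = div_mod_bounds[OF ij(1)] div_mod_bounds[OF ij(2)]
  show "?L $$ (i, j) = (kronecker ?A (1\<^sub>m m) + kronecker ?D ?B) $$ (i, j)"
    using ij b adj_cartesian[OF sg1 sg2] in_verts(3,4)
      class_diag_mat[of "i div m" "j div m", symmetric] ws_eq
    by (simp add: adj_mat_def kronecker_def product_nth id_entry_def del: index_mat_four_block(1))
qed (auto simp: kronecker_def adj_mat_def)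

lemma adj_mat_semi_strong:
  "adj_mat (signed_semi_strong \<Gamma>1 V1 \<Gamma>2) vs =
     kronecker (four_block_mat (1\<^sub>m s) P (transpose_mat P) (- 1\<^sub>m t)) (adj_mat \<Gamma>2 ws)"
  (is "?L = kronecker ?C ?B")
proof (rule eq_matI)
  let ?D = "four_block_mat (1\<^sub>m s) (0\<^sub>m s t) (0\<^sub>m t s) (- 1\<^sub>m t) :: real mat"
  have C: "?C = ?D + adj_mat \<Gamma>1 (xs @ ys)"
    unfolding adj_mat_bipartite
    by (intro eq_matI) (auto simp: biadj_mat_def)
  fix i j
  assume "i < dim_row (kronecker ?C ?B)" "j < dim_col (kronecker ?C ?B)"
  then have ij: "i < (s + t) * m" "j < (s + t) * m"
    by (auto simp: kronecker_def adj_mat_def)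
  note b = div_mod_bounds[OF ij(1)] div_mod_bounds[OF ij(2)]
  show "?L $$ (i, j) = kronecker ?C ?B $$ (i, j)"
    unfolding C
    using ij b adj_semi_strong[OF sg1 sg2] in_verts(3,4)
      class_diag_mat[of "i div m" "j div m", symmetric]
    by (simp add: adj_mat_def kronecker_def product_nth del: index_mat_four_block(1))
qed (auto simp: kronecker_def adj_mat_def)

end

end

theory Submission
  imports Defs
begin

text \<open>Let \<open>B\<close> be the adjacency matrix of the second factor. Up to labeling, both products have an
  adjacency matrix \<open>M = [X, K; L, -Y]\<close> with \<open>X = I\<^sub>s \<otimes> B\<close>, \<open>Y = I\<^sub>t \<otimes> B\<close>, \<open>K = P \<otimes> C\<close>, \<open>L = P\<^sup>T \<otimes> C\<close>,
  where \<open>C\<close> is \<open>I\<close> or \<open>B\<close>. Since \<open>C\<close> commutes with \<open>B\<close>, we have \<open>Y L = L X\<close>, and block elimination gives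
  \<open>det (x - M) \<cdot> det (x + B)\<^sup>s = det (x\<^sup>2 - X\<^sup>2 - K L) \<cdot> det (x + B)\<^sup>t\<close>. The first factor on the right is even
  in \<open>x\<close>, so comparing multiplicities of \<open>c\<close> and \<open>-c\<close> shows that the spectrum of \<open>M\<close> is symmetric
  iff \<open>s (\<sigma>(c) - \<sigma>(-c)) = t (\<sigma>(c) - \<sigma>(-c))\<close> for all \<open>c\<close>, with \<open>\<sigma>(c)\<close> the multiplicity of the root \<open>c\<close> of
  the characteristic polynomial of \<open>B\<close>.\<close>

section \<open>Reflection of polynomials and their roots\<close>

lemma count_image_mset_uminus: "count (image_mset uminus M) (c :: 'a :: group_add) = count M (- c)"
  by (induction M) auto

text \<open>Substituting \<open>-x\<close> turns a factor \<open>x + c\<close> into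
  \<open>c - x\<close>, a unit multiple of \<open>x - c\<close>. One inequality suffices: reflection
  is an involution, so applying it to \<open>p\<close> and to its reflection yields equality in
  \<open>proots_pcompose_reflect\<close>.\<close>

lemma order_pcompose_reflect_le:
  fixes p :: "'a :: idom poly"
  assumes "p \<noteq> 0"
  shows "order (- c) p \<le> order c (pcompose p [:0, -1:])"
proof -
  define n where "n = order (- c) p"
  have "[:c, 1:] ^ n dvd p" using order_1[of "- c" p] by (simp add: n_def)
  then obtain q where q: "p = [:c, 1:] ^ n * q" by (elim dvdE)
  have "pcompose p [:0, -1:] = [:c, -1:] ^ n * pcompose q [:0, -1:]"
    unfolding q pcompose_mult pcompose_hom.hom_power by (simp add: pcompose_pCons)
  moreover have "[:-c, 1:] ^ n dvd [:c, -1:] ^ n"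
    by (rule dvd_power_same) (rule dvdI[of _ _ "[:-1:]"], simp)
  ultimately have "[:-c, 1:] ^ n dvd pcompose p [:0, -1:]" by simp
  moreover have "pcompose p [:0, -1:] \<noteq> 0" using assms by (simp add: pcompose_eq_0_iff)
  ultimately show ?thesis unfolding order_divides n_def by simp
qed

lemma proots_pcompose_reflect:
  fixes p :: "'a :: idom poly"
  assumes "p \<noteq> 0"
  shows "proots (pcompose p [:0, -1:]) = image_mset uminus (proots p)"
proof (rule multiset_eqI)
  fix c
  have nz: "pcompose p [:0, -1:] \<noteq> 0" using assms by (simp add: pcompose_eq_0_iff)
  have "pcompose (pcompose p [:0, -1:]) [:0, -1:] = p"
    by (simp flip: pcompose_assoc add: pcompose_pCons pcompose_idR)
  with order_pcompose_reflect_le[OF nz, of "- c"] order_pcompose_reflect_le[OF assms, of c]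
  have "order c (pcompose p [:0, -1:]) = order (- c) p" by simp
  then show "count (proots (pcompose p [:0, -1:])) c = count (image_mset uminus (proots p)) c"
    using assms nz by (simp add: count_image_mset_uminus)
qed

section \<open>Characteristic polynomials of block matrices\<close>

text \<open>Reduces identities between characteristic polynomials to determinant identities at each
  point \<open>x\<close>, since polynomials over an infinite field are determined by their
  values.\<close>

lemma poly_char_poly_eq_det:
  fixes A :: "'a :: field_char_0 mat"
  assumes "A \<in> carrier_mat n n"
  shows "poly (char_poly A) x = det (x \<cdot>\<^sub>m 1\<^sub>m n - A)"
proof -
  have "- char_matrix A x = x \<cdot>\<^sub>m 1\<^sub>m n - A"
    using assms by (intro eq_matI) (auto simp: char_matrix_def)
  then show ?thesis using char_poly_matrix[OF assms] by metis
qed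

lemma char_poly_nonzero:
  fixes A :: "'a :: field_char_0 mat"
  assumes "A \<in> carrier_mat n n"
  shows "char_poly A \<noteq> 0"
  using degree_monic_char_poly[OF assms] by auto

lemma proots_char_poly_uminus:
  fixes A :: "'a :: field_char_0 mat"
  assumes A: "A \<in> carrier_mat n n"
  shows "proots (char_poly (- A)) = image_mset uminus (proots (char_poly A))"
proof -
  have "char_poly (- A) = Polynomial.smult ((-1) ^ n) (pcompose (char_poly A) [:0, -1:])"
  proof (rule poly_eq_poly_eq_iff[THEN iffD1], rule ext)
    fix x
    have "poly (char_poly (- A)) x = det (x \<cdot>\<^sub>m 1\<^sub>m n - (- A))"
      using A by (intro poly_char_poly_eq_det) simp
    also have "x \<cdot>\<^sub>m 1\<^sub>m n - (- A) = (-1) \<cdot>\<^sub>m (- x \<cdot>\<^sub>m 1\<^sub>m n - A)"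
      using A by (intro eq_matI) auto
    also have "det \<dots> = (-1) ^ n * det (- x \<cdot>\<^sub>m 1\<^sub>m n - A)"
      using A by (subst det_smult) simp
    finally show "poly (char_poly (- A)) x = poly (Polynomial.smult ((-1) ^ n) (pcompose (char_poly A) [:0, -1:])) x"
      using poly_char_poly_eq_det[OF A, of "- x"] by (simp add: poly_pcompose)
  qed
  then show ?thesis using proots_pcompose_reflect[OF char_poly_nonzero[OF A]] by simp
qed

lemma smult_one_minus_four_block_mat:
  fixes A :: "'a :: field_char_0 mat"
  assumes "A \<in> carrier_mat n n" "B \<in> carrier_mat n m" "C \<in> carrier_mat m n" "D \<in> carrier_mat m m"
  shows "x \<cdot>\<^sub>m 1\<^sub>m (n + m) - four_block_mat A B C D =
    four_block_mat (x \<cdot>\<^sub>m 1\<^sub>m n - A) (- B) (- C) (x \<cdot>\<^sub>m 1\<^sub>m m - D)"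
  using assms by (intro eq_matI) auto

lemma char_poly_four_block_diag:
  fixes A :: "'a :: field_char_0 mat"
  assumes A: "A \<in> carrier_mat n n" and D: "D \<in> carrier_mat m m"
  shows "char_poly (four_block_mat A (0\<^sub>m n m) (0\<^sub>m m n) D) = char_poly A * char_poly D"
proof (rule poly_eq_poly_eq_iff[THEN iffD1], rule ext)
  fix x
  have "poly (char_poly (four_block_mat A (0\<^sub>m n m) (0\<^sub>m m n) D)) x =
      det (four_block_mat (x \<cdot>\<^sub>m 1\<^sub>m n - A) (- 0\<^sub>m n m) (- 0\<^sub>m m n) (x \<cdot>\<^sub>m 1\<^sub>m m - D))"
    using A D by (subst poly_char_poly_eq_det[of _ "n + m"])
      (simp_all add: smult_one_minus_four_block_mat)
  also have "\<dots> = det (x \<cdot>\<^sub>m 1\<^sub>m n - A) * det (x \<cdot>\<^sub>m 1\<^sub>m m - D)"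
    by (rule det_four_block_mat_lower_left_zero) (use A D in auto)
  finally show "poly (char_poly (four_block_mat A (0\<^sub>m n m) (0\<^sub>m m n) D)) x =
      poly (char_poly A * char_poly D) x"
    using poly_char_poly_eq_det[OF A] poly_char_poly_eq_det[OF D] by simp
qed

text \<open>Right multiplication of \<open>x - M\<close> by \<open>[x + X, 0; L, 1]\<close> annihilates the lower left block,
  because \<open>(x + Y) L = L (x + X)\<close>.\<close>

lemma char_poly_intertwined_blocks:
  fixes X :: "'a :: field_char_0 mat"
  assumes X: "X \<in> carrier_mat n n" and Y: "Y \<in> carrier_mat m m"
    and K: "K \<in> carrier_mat n m" and L: "L \<in> carrier_mat m n" and YL: "Y * L = L * X"
  shows "char_poly (four_block_mat X K L (- Y)) * char_poly (- X) =
    pcompose (char_poly (X * X + K * L)) [:0, 0, 1:] * char_poly (- Y)"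
proof (rule poly_eq_poly_eq_iff[THEN iffD1], rule ext)
  fix x :: 'a
  let ?n = "x \<cdot>\<^sub>m 1\<^sub>m n" and ?m = "x \<cdot>\<^sub>m 1\<^sub>m m"
  have M: "four_block_mat X K L (- Y) \<in> carrier_mat (n + m) (n + m)"
    using X Y by simp
  have lin: "(?n - X) * (?n + X) = (x * x) \<cdot>\<^sub>m 1\<^sub>m n - X * X"
  proof -
    have "(?n - X) * (?n + X) = ?n * ?n + ?n * X - (X * ?n + X * X)"
      using X by (simp add: minus_mult_distrib_mat[of _ n n _ _ n] mult_add_distrib_mat[of _ n n _ n])
    moreover have "?n * ?n = (x * x) \<cdot>\<^sub>m 1\<^sub>m n" "?n * X = x \<cdot>\<^sub>m X" "X * ?n = x \<cdot>\<^sub>m X"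
      using X by (auto simp: mult_smult_distrib[of _ n n _ n] mult_smult_assoc_mat[of _ n n _ n] intro!: eq_matI)
    ultimately show ?thesis using X by (auto intro!: eq_matI)
  qed
  \<comment> \<open>The terms linear in \<open>x\<close> have cancelled in \<open>lin\<close>, so
    this block depends on \<open>x\<close> only through its square; this is the source of the
    evenness used later.\<close>
  have ul: "(?n - X) * (?n + X) + (- K) * L = (x * x) \<cdot>\<^sub>m 1\<^sub>m n - (X * X + K * L)"
    unfolding lin using X K L by (intro eq_matI) auto
  have ll: "(- L) * (?n + X) + (?m - (- Y)) * L = 0\<^sub>m m n"
  proof -
    have "(- L) * (?n + X) = - (x \<cdot>\<^sub>m L + L * X)"
      using X L by (simp add: mult_add_distrib_mat[of _ m n _ n] mult_smult_distrib[of _ m n _ n])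
        (intro eq_matI, auto)
    moreover have "?m - (- Y) = ?m + Y" using Y by (intro eq_matI) auto
    moreover have "(?m + Y) * L = x \<cdot>\<^sub>m L + L * X"
      using Y L by (simp add: add_mult_distrib_mat[of _ m m _ _ n] YL mult_smult_assoc_mat[of _ m m _ n])
    ultimately show ?thesis using X L by (auto intro!: eq_matI)
  qed
  have nX: "?n - X \<in> carrier_mat n n" "?n + X \<in> carrier_mat n n" and mY: "?m - (- Y) \<in> carrier_mat m m"
    using X Y by auto
  have ur: "(?n - X) * 0\<^sub>m n m + (- K) * 1\<^sub>m m = - K"
    using K nX right_mult_zero_mat[OF nX(1)] by simp
  have lr: "(- L) * 0\<^sub>m n m + (?m - (- Y)) * 1\<^sub>m m = ?m - (- Y)"
    using L mY right_mult_one_mat[OF mY] by simp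
  \<comment> \<open>Multiplying, where a Schur complement would divide, keeps the identity valid at
    every \<open>x\<close>, including those where \<open>x + X\<close> or \<open>x + Y\<close> is
    singular.\<close>
  have "(x \<cdot>\<^sub>m 1\<^sub>m (n + m) - four_block_mat X K L (- Y)) * four_block_mat (?n + X) (0\<^sub>m n m) L (1\<^sub>m m)
      = four_block_mat ((x * x) \<cdot>\<^sub>m 1\<^sub>m n - (X * X + K * L)) (- K) (0\<^sub>m m n) (?m - (- Y))"
    (is "?N * ?T = ?U")
    unfolding smult_one_minus_four_block_mat[OF X K L uminus_carrier_mat[OF Y]]
      mult_four_block_mat[OF nX(1) uminus_carrier_mat[OF K] uminus_carrier_mat[OF L] mY nX(2)
        zero_carrier_mat L one_carrier_mat] ul ll ur lr ..
  then have "det ?N * det ?T = det ?U"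
    using det_mult[OF minus_carrier_mat[OF M], of ?T "x \<cdot>\<^sub>m 1\<^sub>m (n + m)"] nX by simp
  moreover have "det ?T = det (?n + X) * det (1\<^sub>m m)"
    by (rule det_four_block_mat_upper_right_zero) (use X L in auto)
  moreover have "det ?U = det ((x * x) \<cdot>\<^sub>m 1\<^sub>m n - (X * X + K * L)) * det (?m - (- Y))"
    by (rule det_four_block_mat_lower_left_zero) (use X Y K L in auto)
  \<comment> \<open>Identifies the determinant of \<open>?T\<close> as the value at \<open>x\<close>
    of the characteristic polynomial of \<open>- X\<close>.\<close>
  moreover have "?n + X = ?n - (- X)" using X by (intro eq_matI) auto
  ultimately show "poly (char_poly (four_block_mat X K L (- Y)) * char_poly (- X)) x =
      poly (pcompose (char_poly (X * X + K * L)) [:0, 0, 1:] * char_poly (- Y)) x"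
    using poly_char_poly_eq_det[OF M, of x] poly_char_poly_eq_det[of "- X" n x]
      poly_char_poly_eq_det[of "- Y" m x] poly_char_poly_eq_det[of "X * X + K * L" n "x * x"] X Y K L
    by (simp add: poly_pcompose)
qed

section \<open>Kronecker products\<close>

lemma dim_kronecker [simp]:
  "dim_row (kronecker A B) = dim_row A * dim_row B"
  "dim_col (kronecker A B) = dim_col A * dim_col B"
  by (simp_all add: kronecker_def)

lemma kronecker_carrier_mat:
  "A \<in> carrier_mat n m \<Longrightarrow> B \<in> carrier_mat k l \<Longrightarrow> kronecker A B \<in> carrier_mat (n * k) (m * l)"
  by auto

lemma index_kronecker:
  "i < dim_row A * dim_row B \<Longrightarrow> j < dim_col A * dim_col B \<Longrightarrow> kronecker A B $$ (i, j) =
    A $$ (i div dim_row B, j div dim_col B) * B $$ (i mod dim_row B, j mod dim_col B)"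
  by (simp add: kronecker_def)

lemma div_mod_less_mult:
  fixes i :: nat
  assumes "i < n * k"
  shows "i div k < n" "i mod k < k"
  using assms by (auto simp: less_mult_imp_div_less intro!: mod_less_divisor gr0I)

text \<open>Cutting the range into \<open>a\<close> blocks of length \<open>b\<close> makes
  \<open>k div b\<close> the block number and \<open>k mod b\<close> the position inside the block,
  so the sum runs over all pairs.\<close>

lemma sum_div_mod_mult:
  fixes f g :: "nat \<Rightarrow> 'a :: comm_semiring_0"
  shows "(\<Sum>k<a * b. f (k div b) * g (k mod b)) = (\<Sum>i<a. f i) * (\<Sum>j<b. g j)"
proof -
  have "(\<Sum>k<a * b. f (k div b) * g (k mod b)) = (\<Sum>i<a. \<Sum>k\<in>{i * b..<i * b + b}. f (k div b) * g (k mod b))"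
    by (rule sum.nat_group[symmetric])
  also have "\<dots> = (\<Sum>i<a. \<Sum>j<b. f i * g j)"
  proof (rule sum.cong[OF refl])
    fix i
    have "(\<Sum>k\<in>{i * b..<i * b + b}. f (k div b) * g (k mod b)) =
        (\<Sum>j\<in>{0..<b}. f ((j + i * b) div b) * g ((j + i * b) mod b))"
      using sum.shift_bounds_nat_ivl[of "\<lambda>k. f (k div b) * g (k mod b)" 0 "i * b" b]
      by (simp add: add.commute)
    also have "\<dots> = (\<Sum>j<b. f i * g j)"
      by (rule sum.cong) auto
    finally show "(\<Sum>k\<in>{i * b..<i * b + b}. f (k div b) * g (k mod b)) = (\<Sum>j<b. f i * g j)" .
  qed
  finally show ?thesis by (simp add: sum_product)
qed

text \<open>The mixed-product rule: the summation index of an entry splits by \<open>div\<close> and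
  \<open>mod\<close>, and the sum factors by \<open>sum_div_mod_mult\<close>.\<close>

lemma kronecker_mult:
  assumes "A \<in> carrier_mat n1 n2" "B \<in> carrier_mat m1 m2" "C \<in> carrier_mat n2 n3" "D \<in> carrier_mat m2 m3"
  shows "kronecker A B * kronecker C D = kronecker (A * C) (B * D)"
proof (rule eq_matI)
  fix i j assume "i < dim_row (kronecker (A * C) (B * D))" "j < dim_col (kronecker (A * C) (B * D))"
  then have ij: "i < n1 * m1" "j < n3 * m3" using assms by auto
  note b = div_mod_less_mult[OF ij(1)] div_mod_less_mult[OF ij(2)]
  have "(kronecker A B * kronecker C D) $$ (i, j) =
      (\<Sum>k<n2 * m2. kronecker A B $$ (i, k) * kronecker C D $$ (k, j))"
    using ij assms by (simp add: scalar_prod_def atLeast0LessThan)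
  also have "\<dots> = (\<Sum>k<n2 * m2. (A $$ (i div m1, k div m2) * C $$ (k div m2, j div m3)) *
      (B $$ (i mod m1, k mod m2) * D $$ (k mod m2, j mod m3)))"
    using ij assms by (intro sum.cong) (auto simp: index_kronecker)
  also have "\<dots> = (A * C) $$ (i div m1, j div m3) * (B * D) $$ (i mod m1, j mod m3)"
    unfolding sum_div_mod_mult[where f = "\<lambda>k. A $$ (i div m1, k) * C $$ (k, j div m3)"
      and g = "\<lambda>k. B $$ (i mod m1, k) * D $$ (k, j mod m3)"]
    using assms b by (simp add: scalar_prod_def atLeast0LessThan)
  also have "\<dots> = kronecker (A * C) (B * D) $$ (i, j)"
    using ij assms by (simp add: index_kronecker)
  finally show "(kronecker A B * kronecker C D) $$ (i, j) = kronecker (A * C) (B * D) $$ (i, j)" .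
qed (use assms in auto)

text \<open>Each row of the left factor becomes \<open>k\<close> consecutive rows and each column
  \<open>l\<close> consecutive columns, so the block boundaries are merely scaled.\<close>

lemma kronecker_four_block_mat:
  assumes "A \<in> carrier_mat n1 m1" "B \<in> carrier_mat n1 m2" "C \<in> carrier_mat n2 m1" "D \<in> carrier_mat n2 m2"
    and E: "E \<in> carrier_mat k l"
  shows "kronecker (four_block_mat A B C D) E =
    four_block_mat (kronecker A E) (kronecker B E) (kronecker C E) (kronecker D E)"
proof (rule eq_matI)
  let ?R = "four_block_mat (kronecker A E) (kronecker B E) (kronecker C E) (kronecker D E)"
  fix i j assume "i < dim_row ?R" "j < dim_col ?R"
  then have ij: "i < n1 * k + n2 * k" "j < m1 * l + m2 * l" using assms by auto
  have split: "a div b < n \<longleftrightarrow> a < n * b" if "0 < b" for a b n :: nat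
    using that by (rule div_less_iff_less_mult)
  \<comment> \<open>Past the boundary an index drops by a multiple of \<open>b\<close>: the quotient
    drops by \<open>n\<close> and the remainder stays.\<close>
  have shift: "(a - n * b) div b = a div b - n" "(a - n * b) mod b = a mod b"
    if "0 < b" "\<not> a < n * b" for a b n :: nat
  proof -
    from that(2) obtain d where "a = n * b + d" using le_Suc_ex not_less by blast
    with that(1) show "(a - n * b) div b = a div b - n" "(a - n * b) mod b = a mod b" by simp_all
  qed
  \<comment> \<open>An index in range exists, so neither divisor is zero.\<close>
  have pos: "0 < k" "0 < l" using ij by (auto intro: gr0I)
  have ij': "i < (n1 + n2) * k" "j < (m1 + m2) * l" using ij by (simp_all add: distrib_right)
  note b = div_mod_less_mult[OF ij'(1)] div_mod_less_mult[OF ij'(2)]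
  have "i - n1 * k < n2 * k" if "\<not> i < n1 * k" using ij that by linarith
  moreover have "j - m1 * l < m2 * l" if "\<not> j < m1 * l" using ij that by linarith
  ultimately show "kronecker (four_block_mat A B C D) E $$ (i, j) = ?R $$ (i, j)"
    using assms ij ij' b split[OF pos(1)] split[OF pos(2)] shift[OF pos(1)] shift[OF pos(2)]
    by (simp add: index_kronecker)
qed (use assms in \<open>auto simp: distrib_right\<close>)

lemma kronecker_zero_left: "kronecker (0\<^sub>m n m) B = 0\<^sub>m (n * dim_row B) (m * dim_col B)"
  by (rule eq_matI) (auto simp: index_kronecker div_mod_less_mult)

lemma kronecker_one_one: "kronecker (1\<^sub>m 1) B = B"
  by (rule eq_matI) (auto simp: index_kronecker)

lemma kronecker_uminus_left: "kronecker (- A) B = - kronecker A B"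
  by (rule eq_matI) (auto simp: index_kronecker div_mod_less_mult)

lemma kronecker_uminus_right: "kronecker A (- B) = - kronecker A B"
  by (rule eq_matI) (auto simp: index_kronecker div_mod_less_mult)

text \<open>The matrix is block diagonal with \<open>s\<close> copies of \<open>B\<close>; the
  induction splits off one copy at a time.\<close>

lemma char_poly_kronecker_one:
  assumes B: "B \<in> carrier_mat m m"
  shows "char_poly (kronecker (1\<^sub>m s) B) = char_poly B ^ s"
proof (induction s)
  case 0
  \<comment> \<open>For the empty matrix the characteristic polynomial is monic of degree 0, hence
    1.\<close>
  have "kronecker (1\<^sub>m 0) B \<in> carrier_mat 0 0" using kronecker_carrier_mat[OF one_carrier_mat[of 0] B] by simp
  from degree_monic_char_poly[OF this] show ?case
    using monic_degree_0 by (metis power_0)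
next
  case (Suc s)
  have "kronecker (1\<^sub>m (Suc s)) B =
      kronecker (four_block_mat (1\<^sub>m 1) (0\<^sub>m 1 s) (0\<^sub>m s 1) (1\<^sub>m s)) B"
    by simp
  also have "\<dots> = four_block_mat B (0\<^sub>m m (s * m)) (0\<^sub>m (s * m) m) (kronecker (1\<^sub>m s) B)"
    using B by (subst kronecker_four_block_mat[of _ 1 1 _ s _ s]) (simp_all add: kronecker_zero_left kronecker_one_one[simplified])
  also have "char_poly \<dots> = char_poly B * char_poly (kronecker (1\<^sub>m s) B)"
    using B by (intro char_poly_four_block_diag) auto
  finally show ?case using Suc by simp
qed

section \<open>Symmetry of the spectrum\<close>

text \<open>A general \<open>C\<close> commuting with \<open>B\<close> treats both products at once:
  the identity gives the Cartesian and \<open>C = B\<close> the semi-strong product.\<close>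

lemma symmetric_proots_iff:
  fixes B C P :: "real mat"
  assumes B: "B \<in> carrier_mat m m" and C: "C \<in> carrier_mat m m" and BC: "B * C = C * B"
    and P: "P \<in> carrier_mat s t"
  defines "M \<equiv> four_block_mat (kronecker (1\<^sub>m s) B) (kronecker P C)
      (kronecker (transpose_mat P) C) (- kronecker (1\<^sub>m t) B)"
  shows "image_mset uminus (proots (char_poly M)) = proots (char_poly M) \<longleftrightarrow>
    s = t \<or> image_mset uminus (proots (char_poly B)) = proots (char_poly B)"
proof -
  let ?X = "kronecker (1\<^sub>m s) B" and ?Y = "kronecker (1\<^sub>m t) B"
  let ?K = "kronecker P C" and ?L = "kronecker (transpose_mat P) C"
  let ?W = "?X * ?X + ?K * ?L"
  have car: "?X \<in> carrier_mat (s * m) (s * m)" "?Y \<in> carrier_mat (t * m) (t * m)"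
    "?K \<in> carrier_mat (s * m) (t * m)" "?L \<in> carrier_mat (t * m) (s * m)"
    using B C P by auto
  have M: "M \<in> carrier_mat (s * m + t * m) (s * m + t * m)"
    unfolding M_def using car by simp
  have W: "?W \<in> carrier_mat (s * m) (s * m)" using car by simp
  have PT: "transpose_mat P \<in> carrier_mat t s" using P by simp
  \<comment> \<open>By the mixed-product rule both sides have left factor
    \<open>transpose_mat P\<close>, with right factors \<open>B * C\<close> and
    \<open>C * B\<close>.\<close>
  have "?Y * ?L = ?L * ?X"
    using kronecker_mult[OF one_carrier_mat B PT C] kronecker_mult[OF PT C one_carrier_mat B]
      left_mult_one_mat[OF PT] right_mult_one_mat[OF PT] BC by simp
  note blocks = char_poly_intertwined_blocks[OF car this]
  define S where "S = proots (char_poly M)"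
  define \<sigma> where "\<sigma> = proots (char_poly B)"
  define Q where "Q = pcompose (char_poly ?W) [:0, 0, 1:]"
  have Q0: "Q \<noteq> 0" using char_poly_nonzero[OF W] by (simp add: Q_def pcompose_eq_0_iff)
  \<comment> \<open>\<open>Q\<close> is a polynomial in the square of the variable, hence
    even.\<close>
  have "pcompose Q [:0, -1:] = Q"
    by (simp add: Q_def pcompose_pCons flip: pcompose_assoc)
  then have E: "image_mset uminus (proots Q) = proots Q"
    using proots_pcompose_reflect[OF Q0] by simp
  have nz: "char_poly (- B) \<noteq> 0" using B by (intro char_poly_nonzero[of _ m]) simp
  have mB: "- B \<in> carrier_mat m m" using B by simp
  have "char_poly M * char_poly (- B) ^ s = Q * char_poly (- B) ^ t"
    using blocks by (simp add: M_def Q_def char_poly_kronecker_one[OF mB] flip: kronecker_uminus_right)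
  then have "proots (char_poly M * char_poly (- B) ^ s) = proots (Q * char_poly (- B) ^ t)" by simp
  then have key: "S + repeat_mset s (image_mset uminus \<sigma>) = proots Q + repeat_mset t (image_mset uminus \<sigma>)"
    using char_poly_nonzero[OF M] Q0 nz proots_char_poly_uminus[OF B]
    by (simp add: proots_mult proots_power S_def \<sigma>_def)
  \<comment> \<open>The argument \<open>- c\<close> on \<open>\<sigma>\<close> appears because the
    eliminated factors are powers of the characteristic polynomial of \<open>- B\<close>.\<close>
  have cnt: "count S c + s * count \<sigma> (- c) = count (proots Q) c + t * count \<sigma> (- c)" for c
    using arg_cong[OF key, of "\<lambda>N. count N c"] by (simp add: count_image_mset_uminus del: count_proots)
  have Qc: "count (proots Q) (- c) = count (proots Q) c" for c
    using arg_cong[OF E, of "\<lambda>N. count N c"] by (simp add: count_image_mset_uminus del: count_proots)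
  have sym: "image_mset uminus N = N \<longleftrightarrow> (\<forall>c. count N (- c) = count N c)" for N :: "real multiset"
    by (simp add: multiset_eq_iff count_image_mset_uminus)
  have "(\<forall>c. count S (- c) = count S c) \<longleftrightarrow> s = t \<or> (\<forall>c. count \<sigma> (- c) = count \<sigma> c)"
  proof
    assume S: "\<forall>c. count S (- c) = count S c"
    show "s = t \<or> (\<forall>c. count \<sigma> (- c) = count \<sigma> c)"
    proof (rule disjCI)
      assume "\<not> (\<forall>c. count \<sigma> (- c) = count \<sigma> c)"
      then obtain c where c: "count \<sigma> (- c) \<noteq> count \<sigma> c" by blast
      \<comment> \<open>Subtract \<open>cnt\<close> at \<open>- c\<close> from \<open>cnt\<close> at
        \<open>c\<close>: the terms of \<open>S\<close> and \<open>Q\<close> cancel by symmetry.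
        Passing to integers makes the differences meaningful; the common factor is nonzero by the
        choice of \<open>c\<close>.\<close>
      have "int s * (int (count \<sigma> (- c)) - int (count \<sigma> c)) = int t * (int (count \<sigma> (- c)) - int (count \<sigma> c))"
        using arg_cong[OF cnt[of c], of int] arg_cong[OF cnt[of "- c"], of int] Qc[of c] S
        by (simp add: right_diff_distrib)
      then show "s = t" using c by simp
    qed
  next
    assume "s = t \<or> (\<forall>c. count \<sigma> (- c) = count \<sigma> c)"
    then show "\<forall>c. count S (- c) = count S c"
    proof
      assume "s = t"
      then show ?thesis using cnt Qc by simp
    next
      assume *: "\<forall>c. count \<sigma> (- c) = count \<sigma> c"
      show ?thesis
      proof
        fix c show "count S (- c) = count S c"
          using cnt[of c] cnt[of "- c"] Qc[of c] * by simp
      qed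
    qed
  qed
  then show ?thesis unfolding sym[of S, symmetric] sym[of \<sigma>, symmetric] by (simp add: S_def \<sigma>_def)
qed

theorem theorem4p3:
  fixes \<Gamma>1 :: "'a sgraph" and \<Gamma>2 :: "'b sgraph" and V1 V2 :: "'a set"
  assumes "signed_graph \<Gamma>1" and "bipartition \<Gamma>1 V1 V2" and "signed_graph \<Gamma>2"
  shows "(symmetric_spectrum (signed_cartesian \<Gamma>1 V1 \<Gamma>2) \<longleftrightarrow>
            balanced V1 V2 \<or> symmetric_spectrum \<Gamma>2) \<and>
         (symmetric_spectrum (signed_semi_strong \<Gamma>1 V1 \<Gamma>2) \<longleftrightarrow>
            balanced V1 V2 \<or> symmetric_spectrum \<Gamma>2)"
proof -
  have "finite V1" "finite V2" "finite (verts \<Gamma>2)"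
    using assms by (auto simp: signed_graph_def bipartition_def intro: finite_subset)
  then obtain xs ys ws where xs: "set xs = V1" "distinct xs" and ys: "set ys = V2" "distinct ys"
    and ws: "set ws = verts \<Gamma>2" "distinct ws"
    using finite_distinct_list by metis
  interpret labeled_bipartite_pair \<Gamma>1 \<Gamma>2 V1 V2 xs ys ws
    using assms xs ys ws by unfold_locales (auto simp: labeling_def)
  let ?B = "adj_mat \<Gamma>2 ws"
  have B: "?B \<in> carrier_mat m m" by (simp add: adj_mat_def)
  have P: "P \<in> carrier_mat s t" by (simp add: biadj_mat_def)
  have PT: "transpose_mat P \<in> carrier_mat t s" using P by simp
  have bal: "balanced V1 V2 \<longleftrightarrow> s = t"
    using xs ys distinct_card unfolding balanced_def by metis
  \<comment> \<open>The two Kronecker summands are split into blocks and added: one supplies the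
    off-diagonal blocks, the other the diagonal ones.\<close>
  have cart: "adj_mat (signed_cartesian \<Gamma>1 V1 \<Gamma>2) vs = four_block_mat (kronecker (1\<^sub>m s) ?B)
      (kronecker P (1\<^sub>m m)) (kronecker (transpose_mat P) (1\<^sub>m m)) (- kronecker (1\<^sub>m t) ?B)"
    unfolding adj_mat_cartesian adj_mat_bipartite
      kronecker_four_block_mat[OF zero_carrier_mat P PT zero_carrier_mat one_carrier_mat]
      kronecker_four_block_mat[OF one_carrier_mat zero_carrier_mat zero_carrier_mat
        uminus_carrier_mat[OF one_carrier_mat] B]
    using B P by (subst add_four_block_mat[of _ "s * m" "s * m" _ "t * m" _ "t * m"])
      (auto simp: kronecker_zero_left kronecker_uminus_left intro!: cong_four_block_mat)
  have semi: "adj_mat (signed_semi_strong \<Gamma>1 V1 \<Gamma>2) vs = four_block_mat (kronecker (1\<^sub>m s) ?B)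
      (kronecker P ?B) (kronecker (transpose_mat P) ?B) (- kronecker (1\<^sub>m t) ?B)"
    unfolding adj_mat_semi_strong
      kronecker_four_block_mat[OF one_carrier_mat P PT uminus_carrier_mat[OF one_carrier_mat] B]
    by (simp add: kronecker_uminus_left)
  have comm: "?B * 1\<^sub>m m = 1\<^sub>m m * ?B" using B by simp
  show ?thesis
    using symmetric_proots_iff[OF B one_carrier_mat comm P] symmetric_proots_iff[OF B B refl P]
    unfolding symmetric_spectrum_def graph_spectrum_labeling[OF labeling_products(1)]
      graph_spectrum_labeling[OF labeling_products(2)] graph_spectrum_labeling[OF local.ws]
      cart semi bal by blast
qed

end
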